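(* Let $\omega$ be a generic multiplicative 2-cocycle on the triangles of the simplex with vertices $1,\dots,6$ (in particular $\omega_s\neq-1$ for all triangles $s$), and let $\mathcal W_{ijklm}$ be the corresponding delta function pentachoron weights. Then $$\int \mathcal W_{12345}\mathcal W_{12346}\mathcal W_{12356}\,\mathrm dx_{1234}\,\mathrm dy_{1234}\,\mathrm dx_{1235}\,\mathrm dy_{1235}\,\mathrm dx_{1236}\,\mathrm dy_{1236}$$ $$=\mathrm{const}\int \mathcal W_{12456}\mathcal W_{13456}\mathcal W_{23456}\,\mathrm dx_{1456}\,\mathrm dy_{1456}\,\mathrm dx_{2456}\,\mathrm dy_{2456}\,\mathrm dx_{3456}\,\mathrm dy_{3456},$$ where the integrals are formal and $\mathrm{const}$ is a nonzero constant.
   Context: A multiplicative 2-cocycle assigns to each oriented triangle $s=ijk$ a number $\omega_s\in\mathbb C^*$ with $\omega_{-s}=\omega_s^{-1}$ for the opposite orientation and $\omega_{ijk}\omega_{ikl}=\omega_{ijl}\omega_{jkl}$. "Generic" means belonging to some nonempty Zariski-open subset of the variety of such cocycles. Given $\omega$, put $\nu_{1j}=1$ and $\nu_{ij}=\omega_{1ij}$ for $1<i<j\le6$, so that $\omega_{ijk}=\nu_{ij}\nu_{jk}\nu_{ik}^{-1}$ for $i<j<k$. To each tetrahedron $t=ijkl$, $i<j<k<l$, attach two complex variables $x_t,y_t$. Define numbers $\xi_b^{(t)},\eta_b^{(t)}$ for the six edges $b\subset t$ by $$(\xi_{ij},\xi_{ik},\xi_{il},\xi_{jk},\xi_{jl},\xi_{kl})^{(ijkl)}=\bigl(0,\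 \nu_{il}(\nu_{jk}\nu_{kl}+\nu_{jl}),\ -\nu_{ik}(\nu_{jk}\nu_{kl}+\nu_{jl}),\ -\nu_{jl}(\nu_{ik}\nu_{kl}+\nu_{il}),\ \nu_{jk}(\nu_{ik}\nu_{kl}+\nu_{il}),\ \nu_{ik}\nu_{jl}-\nu_{il}\nu_{jk}\bigr),$$ $$(\eta_{ij},\eta_{ik},\eta_{il},\eta_{jk},\eta_{jl},\eta_{kl})^{(ijkl)}=\bigl(-\nu_{ik}(\nu_{jk}\nu_{kl}+\nu_{jl}),\ \nu_{ij}(\nu_{jk}\nu_{kl}+\nu_{jl}),\ 0,\ \nu_{ik}\nu_{kl}-\nu_{ij}\nu_{jl},\ \nu_{ij}\nu_{jk}+\nu_{ik},\ -\nu_{ij}\nu_{jk}-\nu_{ik}\bigr).$$ For a pentachoron $v=i_1i_2i_3i_4i_5$, $i_1<\dots<i_5$, let $\epsilon_t=+1$ if $t$ is obtained from $v$ by omitting $i_1$, $i_3$ or $i_5$, and $\epsilon_t=-1$ if by omitting $i_2$ or $i_4$. For each edge $b\subset v$ define the linear form $$\phi_b^{(v)}=\sum_{b\subset t\subset v}\epsilon_t\bigl(\xi_b^{(t)}x_t+\eta_b^{(t)}y_t\bigr).$$ When $\omega_s\ne-1$ for all $s$, the ten forms $\phi_b^{(v)}$ span a 5-dimensional space, and $$\mathcal W_v=\mathrm{const}\cdot\prod\delta\bigl(\phi_b^{(v)}\bigr),$$ the product being over any five linearly independent $\phi_b^{(v)}$. Formal calculus: a product $\prod\delta(\ell_i)$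 of delta functions of linearly independent complex linear forms $\ell_i$ depends, up to a nonzero constant, only on the linear span of the $\ell_i$. The formal integral over a variable is performed by using one of the delta functions whose argument contains that variable to eliminate it; thus integrating $\prod\delta(\ell_i)$ over a variable $z$ occurring in the $\ell_i$ gives (up to a nonzero constant) the product of delta functions for the subspace of those forms in the span of the $\ell_i$ that do not contain $z$. *)

theory Defs
  imports Complex_Main "HOL-Library.FuncSet" "HOL-Library.Function_Algebras"
begin

section \<open>Zariski-open subsets of a variety\<close>

text \<open>Points of an affine space with coordinates indexed by \<open>I\<close> are functions whose values
  outside \<open>I\<close> are never inspected.\<close>

inductive_set poly_functions :: "'i set \<Rightarrow> (('i \<Rightarrow> complex) \<Rightarrow> complex) set" for I :: "'i set" where
  const: "(\<lambda>x. c) \<in> poly_functions I"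
| coord: "i \<in> I \<Longrightarrow> (\<lambda>x. x i) \<in> poly_functions I"
| add: "p \<in> poly_functions I \<Longrightarrow> q \<in> poly_functions I \<Longrightarrow> (\<lambda>x. p x + q x) \<in> poly_functions I"
| mult: "p \<in> poly_functions I \<Longrightarrow> q \<in> poly_functions I \<Longrightarrow> (\<lambda>x. p x * q x) \<in> poly_functions I"

definition zariski_closed_in :: "'i set \<Rightarrow> ('i \<Rightarrow> complex) set \<Rightarrow> ('i \<Rightarrow> complex) set \<Rightarrow> bool" where
  "zariski_closed_in I V Z \<longleftrightarrow>
     (\<exists>P. P \<subseteq> poly_functions I \<and> Z = {x \<in> V. \<forall>p\<in>P. p x = 0})"

definition zariski_open_in :: "'i set \<Rightarrow> ('i \<Rightarrow> complex) set \<Rightarrow> ('i \<Rightarrow> complex) set \<Rightarrow> bool" where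
  "zariski_open_in I V U \<longleftrightarrow> U \<subseteq> V \<and> zariski_closed_in I V (V - U)"


section \<open>Multiplicative 2-cocycles on the 5-simplex\<close>

definition triangles :: "(nat \<times> nat \<times> nat) set" where
  "triangles = {(i, j, k). {i, j, k} \<subseteq> {1..6} \<and> distinct [i, j, k]}"

text \<open>An oriented triangle is an ordered triple up to even permutations, so a function of
  oriented triangles is a cyclically invariant function of triples.\<close>

definition cocycles :: "(nat \<times> nat \<times> nat \<Rightarrow> complex) set" where
  "cocycles = {\<omega> \<in> extensional triangles.
     (\<forall>i j k. (i, j, k) \<in> triangles \<longrightarrow>
        \<omega> (i, j, k) \<noteq> 0 \<and> \<omega> (j, k, i) = \<omega> (i, j, k) \<and> \<omega> (j, i, k) = inverse (\<omega> (i, j, k))) \<and>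
     (\<forall>i j k l. {i, j, k, l} \<subseteq> {1..6} \<and> distinct [i, j, k, l] \<longrightarrow>
        \<omega> (i, j, k) * \<omega> (i, k, l) = \<omega> (i, j, l) * \<omega> (j, k, l))}"

definition nu :: "(nat \<times> nat \<times> nat \<Rightarrow> complex) \<Rightarrow> nat \<Rightarrow> nat \<Rightarrow> complex" where
  "nu \<omega> i j = (if i = 1 then 1 else \<omega> (1, i, j))"


section \<open>Linear forms\<close>

text \<open>Tetrahedra and pentachora are strictly increasing tuples of vertices, edges are
  strictly increasing pairs.\<close>

type_synonym edge = "nat \<times> nat"
type_synonym tet = "nat \<times> nat \<times> nat \<times> nat"
type_synonym pent = "nat \<times> nat \<times> nat \<times> nat \<times> nat"

datatype var = X tet | Y tet

text \<open>A linear form is its coefficient function.\<close>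

type_synonym form = "var \<Rightarrow> complex"

definition form_scale :: "complex \<Rightarrow> ('v \<Rightarrow> complex) \<Rightarrow> 'v \<Rightarrow> complex" where
  "form_scale c f = (\<lambda>z. c * f z)"

global_interpretation lf: vector_space "form_scale :: complex \<Rightarrow> ('v \<Rightarrow> complex) \<Rightarrow> 'v \<Rightarrow> complex"
  by standard (auto simp: form_scale_def plus_fun_def algebra_simps)

fun xi :: "(nat \<Rightarrow> nat \<Rightarrow> complex) \<Rightarrow> tet \<Rightarrow> edge \<Rightarrow> complex" where
  "xi \<nu> (i, j, k, l) b =
    (if b = (i, j) then 0
     else if b = (i, k) then \<nu> i l * (\<nu> j k * \<nu> k l + \<nu> j l)
     else if b = (i, l) then - \<nu> i k * (\<nu> j k * \<nu> k l + \<nu> j l)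
     else if b = (j, k) then - \<nu> j l * (\<nu> i k * \<nu> k l + \<nu> i l)
     else if b = (j, l) then \<nu> j k * (\<nu> i k * \<nu> k l + \<nu> i l)
     else if b = (k, l) then \<nu> i k * \<nu> j l - \<nu> i l * \<nu> j k
     else 0)"

fun eta :: "(nat \<Rightarrow> nat \<Rightarrow> complex) \<Rightarrow> tet \<Rightarrow> edge \<Rightarrow> complex" where
  "eta \<nu> (i, j, k, l) b =
    (if b = (i, j) then - \<nu> i k * (\<nu> j k * \<nu> k l + \<nu> j l)
     else if b = (i, k) then \<nu> i j * (\<nu> j k * \<nu> k l + \<nu> j l)
     else if b = (i, l) then 0
     else if b = (j, k) then \<nu> i k * \<nu> k l - \<nu> i j * \<nu> j l
     else if b = (j, l) then \<nu> i j * \<nu> j k + \<nu> i k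
     else if b = (k, l) then - \<nu> i j * \<nu> j k - \<nu> i k
     else 0)"

text \<open>The form \<open>\<xi>\<^sub>b x\<^sub>t + \<eta>\<^sub>b y\<^sub>t\<close>; it is zero if \<open>b\<close> is not an edge of \<open>t\<close>, so the sum defining
  \<open>phi\<close> may run over all five faces of the pentachoron.\<close>

definition tet_form :: "(nat \<Rightarrow> nat \<Rightarrow> complex) \<Rightarrow> tet \<Rightarrow> edge \<Rightarrow> form" where
  "tet_form \<nu> t b = (\<lambda>z. case z of X s \<Rightarrow> (if s = t then xi \<nu> t b else 0)
                                | Y s \<Rightarrow> (if s = t then eta \<nu> t b else 0))"

fun phi :: "(nat \<times> nat \<times> nat \<Rightarrow> complex) \<Rightarrow> pent \<Rightarrow> edge \<Rightarrow> form" where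
  "phi \<omega> (i1, i2, i3, i4, i5) b =
     tet_form (nu \<omega>) (i2, i3, i4, i5) b - tet_form (nu \<omega>) (i1, i3, i4, i5) b
   + tet_form (nu \<omega>) (i1, i2, i4, i5) b - tet_form (nu \<omega>) (i1, i2, i3, i5) b
   + tet_form (nu \<omega>) (i1, i2, i3, i4) b"

fun edges :: "pent \<Rightarrow> edge set" where
  "edges (i1, i2, i3, i4, i5) =
     {(p, q). p < q \<and> {p, q} \<subseteq> {i1, i2, i3, i4, i5}}"

definition pentachora :: "pent set" where
  "pentachora = {(i1, i2, i3, i4, i5). 1 \<le> i1 \<and> i1 < i2 \<and> i2 < i3 \<and> i3 < i4 \<and> i4 < i5 \<and> i5 \<le> 6}"


section \<open>Formal calculus of delta functions\<close>

text \<open>A list of linearly independent forms \<open>[\<ell>\<^sub>1, \<dots>, \<ell>\<^sub>n]\<close> stands for the product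
  \<open>\<delta>(\<ell>\<^sub>1) \<dots> \<delta>(\<ell>\<^sub>n)\<close> taken up to a nonzero constant factor; multiplication is concatenation.
  A product whose forms are linearly dependent has no meaning.\<close>

definition lin_indep :: "('v \<Rightarrow> complex) list \<Rightarrow> bool" where
  "lin_indep ls \<longleftrightarrow> distinct ls \<and> lf.independent (set ls)"

text \<open>Equality of two products up to a nonzero constant.\<close>

definition delta_eq :: "('v \<Rightarrow> complex) list \<Rightarrow> ('v \<Rightarrow> complex) list \<Rightarrow> bool" where
  "delta_eq ls ms \<longleftrightarrow> lin_indep ls \<and> lin_indep ms \<and> lf.span (set ls) = lf.span (set ms)"

text \<open>\<open>delta_integral z ls ms\<close>: \<open>ms\<close> is a value of the integral of \<open>ls\<close> over \<open>z\<close>, got by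
  solving \<open>l = 0\<close> for \<open>z\<close>, where \<open>l\<close> is one of the forms containing \<open>z\<close>, and substituting the
  solution into the other forms.  If no form contains \<open>z\<close>, the integral has no value.\<close>

inductive delta_integral :: "'v \<Rightarrow> ('v \<Rightarrow> complex) list \<Rightarrow> ('v \<Rightarrow> complex) list \<Rightarrow> bool" for z :: 'v where
  "lin_indep (ls @ l # ms) \<Longrightarrow> l z \<noteq> 0 \<Longrightarrow>
     delta_integral z (ls @ l # ms) (map (\<lambda>f. f - form_scale (f z / l z) l) (ls @ ms))"

fun delta_integrals :: "'v list \<Rightarrow> ('v \<Rightarrow> complex) list \<Rightarrow> ('v \<Rightarrow> complex) list \<Rightarrow> bool" where
  "delta_integrals [] ls ms \<longleftrightarrow> ms = ls"
| "delta_integrals (z # zs) ls ms \<longleftrightarrow> (\<exists>ks. delta_integral z ls ks \<and> delta_integrals zs ks ms)"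

text \<open>The pentachoron weight is determined up to a constant, so it is rendered as a relation that
  admits every choice of five linearly independent forms.\<close>

definition is_weight :: "(nat \<times> nat \<times> nat \<Rightarrow> complex) \<Rightarrow> pent \<Rightarrow> form list \<Rightarrow> bool" where
  "is_weight \<omega> v W \<longleftrightarrow> length W = 5 \<and> set W \<subseteq> phi \<omega> v ` edges v \<and> lin_indep W"

end

theory Submission
  imports Defs
begin

text \<open>
  The forms of a pentachoron satisfy one relation per vertex \<open>i\<close>, namely
  \<open>\<Sum>\<^bsub>j<i\<^esub> \<phi>\<^bsub>ji\<^esub> + \<Sum>\<^bsub>j>i\<^esub> \<nu>\<^bsub>ij\<^esub> \<phi>\<^bsub>ij\<^esub> = 0\<close>. If no \<open>\<omega>\<^sub>s\<close> is \<open>-1\<close>, these bound the dimension of their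
  span by 5. An alternating sum of \<open>\<phi>\<^sub>b\<close> over the three pentachora on one side contains no inner
  variable, and it is the same form for both sides since the alternating sum over all six
  pentachora vanishes. Nine of these common forms are linearly independent. Together with six
  forms that can be used to eliminate the six inner variables one after another, they give 15
  independent forms in the span of the three weights. So all dimension bounds are attained, and
  either integral is the product of delta functions of the nine common forms. Hence the
  condition \<open>\<omega>\<^sub>s \<noteq> -1\<close> alone is generic enough.
\<close>

section \<open>Independence and spans by counting\<close>

text \<open>A repeated or redundant entry of \<open>ls\<close> would leave fewer than
  \<open>card B\<close> forms spanning a space that contains the independent set \<open>B\<close>,
  against the exchange lemma.\<close>

lemma lin_indepI_card:
  assumes "lf.independent B" "B \<subseteq> lf.span (set ls)" "length ls \<le> card B" 
  shows "lin_indep ls"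
proof -
  have le: "card B \<le> card T" if "set ls \<subseteq> lf.span T" "finite T" for T
  proof -
    have "B \<subseteq> lf.span T"
      using assms(2) lf.span_minimal[OF that(1) lf.subspace_span] by blast
    thus ?thesis using lf.independent_span_bound[OF that(2) assms(1)] by blast
  qed
  have "card B \<le> card (set ls)"
    by (rule le) (auto intro: lf.span_base)
  hence c: "card (set ls) = length ls"
    using assms(3) card_length[of ls] by linarith
  have "lf.independent (set ls)"
  proof
    assume "lf.dependent (set ls)"
    then obtain a where a: "a \<in> set ls" "a \<in> lf.span (set ls - {a})"
      by (auto simp: lf.dependent_def)
    have "set ls \<subseteq> lf.span (set ls - {a})"
      using a by (auto intro: lf.span_base)
    hence "card B \<le> card (set ls - {a})"
      by (rule le) simp
    also have "\<dots> < card (set ls)"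
      using a(1) by (meson List.finite_set card_Diff1_less)
    finally show False using assms(3) c by linarith
  qed
  thus ?thesis using c by (simp add: lin_indep_def card_distinct)
qed

lemma lin_indep_appendD:
  assumes "lin_indep (ls @ ms)"
  shows "lin_indep ls" "lin_indep ms"
  using assms by (auto simp: lin_indep_def dest: lf.dependent_mono)

text \<open>A member of \<open>ls\<close> outside the span of \<open>B\<close> could be added to
  \<open>B\<close>, giving more independent elements than \<open>ls\<close> has entries to span
  them.\<close>

lemma span_eq_of_card:
  assumes "lf.independent B" "B \<subseteq> lf.span (set ls)" "length ls \<le> card B" 
  shows "lf.span (set ls) = lf.span B"
proof
  show "lf.span B \<subseteq> lf.span (set ls)"
    using assms(2) by (rule lf.span_minimal[OF _ lf.subspace_span])
  have fin: "finite B"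
    using lf.independent_span_bound[OF _ assms(1,2)] by auto
  have "a \<in> lf.span B" if "a \<in> set ls" for a
  proof (rule ccontr)
    assume a: "a \<notin> lf.span B"
    hence "lf.independent (insert a B)"
      using assms(1) by (simp add: lf.independent_insert)
    moreover have "insert a B \<subseteq> lf.span (set ls)"
      using that assms(2) by (auto intro: lf.span_base)
    ultimately have "card (insert a B) \<le> card (set ls)"
      using lf.independent_span_bound[OF List.finite_set] by blast
    moreover have "a \<notin> B" using a lf.span_base by blast
    ultimately show False
      using fin assms(3) card_length[of ls] by simp
  qed
  thus "lf.span (set ls) \<subseteq> lf.span B"
    by (intro lf.span_minimal[OF _ lf.subspace_span]) blast
qed

text \<open>Reduces independence to a comparison of coefficients over an index set. Two indices with
  equal images would give a relation with coefficients 1 and -1.\<close>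

lemma independent_imageI:
  fixes F :: "'b \<Rightarrow> 'v \<Rightarrow> complex"
  assumes "finite E"
    and ind: "\<And>c. (\<And>z. (\<Sum>b\<in>E. c b * F b z) = 0) \<Longrightarrow> \<forall>b\<in>E. c b = 0"
  shows "inj_on F E \<and> lf.independent (F ` E)"
proof
  show inj: "inj_on F E"
  proof (rule inj_onI, rule ccontr)
    fix a b assume ab: "a \<in> E" "b \<in> E" "F a = F b" "a \<noteq> b"
    define c :: "'b \<Rightarrow> complex" where "c = (\<lambda>x. if x = a then 1 else if x = b then -1 else 0)"
    have "(\<Sum>x\<in>E. c x * F x z) = 0" for z
    proof -
      have "(\<Sum>x\<in>E. c x * F x z) = (\<Sum>x\<in>{a, b}. c x * F x z)"
        by (rule sum.mono_neutral_right) (use ab assms(1) in \<open>auto simp: c_def\<close>)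
      also have "\<dots> = 0" using ab by (simp add: c_def)
      finally show ?thesis .
    qed
    from ind[OF this] ab(1) show False by (auto simp: c_def)
  qed
  show "lf.independent (F ` E)"
  proof
    assume "lf.dependent (F ` E)"
    then obtain u where u: "\<exists>v\<in>F ` E. u v \<noteq> 0" "(\<Sum>v\<in>F ` E. form_scale (u v) v) = 0"
      using assms(1) by (auto simp: lf.dependent_finite)
    have sum_apply: "(\<Sum>b\<in>A. G b) z = (\<Sum>b\<in>A. G b z)" for A z and G :: "'b \<Rightarrow> 'v \<Rightarrow> complex"
      by (induction A rule: infinite_finite_induct) auto
    have "(\<Sum>b\<in>E. u (F b) * F b z) = 0" for z
      using fun_cong[OF u(2), of z]
      by (simp add: sum.reindex[OF inj] sum_apply form_scale_def)
    from ind[OF this] u(1) show False by blast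
  qed
qed

section \<open>Formal integration as elimination on spans\<close>

text \<open>The effect of successive integrations seen on the span alone: each variable must still
  occur once the forms containing earlier variables have been discarded.\<close>

fun eliminable :: "'v list \<Rightarrow> ('v \<Rightarrow> complex) set \<Rightarrow> bool" where
  "eliminable [] S \<longleftrightarrow> True"
| "eliminable (z # zs) S \<longleftrightarrow> (\<exists>f\<in>S. f z \<noteq> 0) \<and> eliminable zs {f \<in> S. f z = 0}"

lemma subspace_vanishing: "lf.subspace {f. f z = 0}"
  by (simp add: lf.subspace_def form_scale_def)

text \<open>One form per variable gives a staircase: the form chosen for \<open>z\<close> contains
  \<open>z\<close>, while those chosen later and all of \<open>G\<close> do not, so it lies outside
  their span.\<close>

lemma eliminable_extend:
  assumes "eliminable zs S" "lf.independent G" "finite G" "G \<subseteq> {f \<in> S. \<forall>z\<in>set zs. f z = 0}"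
  shows "\<exists>B. lf.independent B \<and> B \<subseteq> S \<and> card B = length zs + card G"
  using assms
proof (induction zs arbitrary: S)
  case Nil
  thus ?case by auto
next
  case (Cons z zs)
  have "eliminable zs {f \<in> S. f z = 0}"
    and "G \<subseteq> {f \<in> {f \<in> S. f z = 0}. \<forall>z\<in>set zs. f z = 0}"
    using Cons.prems by auto
  from Cons.IH[OF this(1) Cons.prems(2,3) this(2)]
  obtain B where B: "lf.independent B" "B \<subseteq> {f \<in> S. f z = 0}" "card B = length zs + card G"
    by blast
  obtain f where f: "f \<in> S" "f z \<noteq> 0" using Cons.prems by auto
  show ?case
  \<comment> \<open>\<open>card\<close> is 0 for infinite sets too. Here \<open>zs\<close> is empty
    and \<open>card G\<close> is 0, so \<open>{f}\<close> has the required size 1; in the other case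
    \<open>B\<close> is finite.\<close>
  proof (cases "card B = 0")
    case True
    have "lf.independent {f}" using f by auto
    thus ?thesis using True B f by (intro exI[of _ "{f}"]) auto
  next
    case False
    have "lf.span B \<subseteq> {f. f z = 0}"
      using B(2) by (intro lf.span_minimal[OF _ subspace_vanishing]) blast
    hence "f \<notin> lf.span B" using f by blast
    moreover from this have "f \<notin> B" using lf.span_base by blast
    ultimately show ?thesis using B f False card_ge_0_finite[of B]
      by (intro exI[of _ "insert f B"]) (auto simp: lf.independent_insert)
  qed
qed

text \<open>Substitution is the projection \<open>g\<close> along \<open>l\<close> onto the forms
  without \<open>z\<close>, and each old form is its projection plus a multiple of
  \<open>l\<close>.\<close>

lemma delta_integral_span:
  assumes "delta_integral z ls ms"
  shows "lin_indep ms \<and> length ls = Suc (length ms) \<and>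
    lf.span (set ms) = {f \<in> lf.span (set ls). f z = 0}"
  using assms
proof cases
  case (1 ps l qs)
  define g where "g = (\<lambda>f. f - form_scale (f z / l z) l)"
  define A where "A = set (ps @ qs)"
  have ls: "set ls = insert l A" and ms: "ms = map g (ps @ qs)" "set ms = g ` A"
    using 1 by (auto simp: g_def A_def)
  have gz: "g f z = 0" for f using 1 by (simp add: g_def form_scale_def)
  have A_sub: "insert l A \<subseteq> lf.span (insert l (g ` A))"
  proof -
    have "f \<in> lf.span (insert l (g ` A))" if "f \<in> A" for f
    proof -
      have "g f + form_scale (f z / l z) l \<in> lf.span (insert l (g ` A))"
        using that by (intro lf.span_add lf.span_scale lf.span_base) auto
      thus ?thesis by (simp add: g_def)
    qed
    thus ?thesis by (auto intro: lf.span_base)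
  qed
  have "lin_indep (l # ms)"
  proof (rule lin_indepI_card)
    show "lf.independent (set ls)" using 1 by (simp add: lin_indep_def)
    show "set ls \<subseteq> lf.span (set (l # ms))" using A_sub by (simp only: ls ms(2) list.set)
    show "length (l # ms) \<le> card (set ls)"
      using 1 distinct_card[of ls] by (simp add: lin_indep_def)
  qed
  hence "lin_indep ms"
    using lin_indep_appendD(2)[of "[l]" ms] by simp
  moreover have "lf.span (g ` A) = {f \<in> lf.span (insert l A). f z = 0}"
  proof (intro equalityI subsetI)
    fix f assume f: "f \<in> lf.span (g ` A)"
    have "g ` A \<subseteq> {f. f z = 0}" using gz by auto
    from lf.span_minimal[OF this subspace_vanishing] have "f z = 0" using f by blast
    moreover have "g ` A \<subseteq> lf.span (insert l A)"
      unfolding g_def by (auto intro!: lf.span_diff lf.span_scale intro: lf.span_base)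
    from lf.span_minimal[OF this lf.subspace_span]
    have "f \<in> lf.span (insert l A)" using f by blast
    ultimately show "f \<in> {f \<in> lf.span (insert l A). f z = 0}" by simp
  next
    fix f assume f: "f \<in> {f \<in> lf.span (insert l A). f z = 0}"
    hence "f \<in> lf.span (insert l (g ` A))"
      using lf.span_minimal[OF A_sub lf.subspace_span] by blast
    \<comment> \<open>Only \<open>l\<close> contains \<open>z\<close> here, so the multiple
      \<open>k\<close> of \<open>l\<close> in \<open>f\<close> is read off at \<open>z\<close> and
      must be 0.\<close>
    then obtain k where k: "f - form_scale k l \<in> lf.span (g ` A)"
      by (auto simp: lf.span_breakdown_eq)
    have "g ` A \<subseteq> {f. f z = 0}" using gz by auto
    from lf.span_minimal[OF this subspace_vanishing]
    have "(f - form_scale k l) z = 0" using k by blast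
    hence "k = 0" using f 1 by (simp add: form_scale_def)
    thus "f \<in> lf.span (g ` A)" using k by (simp add: form_scale_def zero_fun_def[symmetric])
  qed
  moreover have "length ls = Suc (length ms)" using 1 by simp
  ultimately show ?thesis unfolding ls ms(2) by blast
qed

lemma delta_integrals_span:
  assumes "delta_integrals zs ls ms" "lin_indep ls"
  shows "lin_indep ms \<and> length ls = length ms + length zs \<and>
    lf.span (set ms) = {f \<in> lf.span (set ls). \<forall>z\<in>set zs. f z = 0}"
  using assms
proof (induction zs arbitrary: ls)
  case (Cons z zs)
  then obtain ks where "delta_integral z ls ks" "delta_integrals zs ks ms" by auto
  with Cons.IH[of ks] delta_integral_span[of z ls ks] show ?case by auto
qed auto

text \<open>A variable occurring somewhere in the span occurs in a listed form, which serves as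
  pivot; the span that remains is the set in the recursion of \<open>eliminable\<close>.\<close>

lemma delta_integrals_exist:
  assumes "eliminable zs (lf.span (set ls))" "lin_indep ls"
  shows "\<exists>ms. delta_integrals zs ls ms"
  using assms
proof (induction zs arbitrary: ls)
  case (Cons z zs)
  have "\<exists>l\<in>set ls. l z \<noteq> 0"
  proof (rule ccontr)
    assume "\<not> ?thesis"
    hence "set ls \<subseteq> {f. f z = 0}" by auto
    hence "lf.span (set ls) \<subseteq> {f. f z = 0}" by (rule lf.span_minimal[OF _ subspace_vanishing])
    thus False using Cons.prems by auto
  qed
  then obtain l ps qs where l: "ls = ps @ l # qs" "l z \<noteq> 0" by (metis split_list)
  then obtain ks where ks: "delta_integral z ls ks"
    using Cons.prems delta_integral.intros[of ps l qs z] by auto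
  have "\<exists>ms. delta_integrals zs ks ms"
    using Cons delta_integral_span[OF ks] by simp
  thus ?case using ks by auto
qed auto

text \<open>The count behind both sides: six pivots and the nine forms of \<open>G\<close> make 15,
  as many as three spanning lists of five, so nothing is redundant. The lists \<open>C1\<close>,
  \<open>C2\<close>, \<open>C3\<close> are only assumed to span; their independence comes out of the
  count.\<close>

lemma integral_of_weights:
  fixes V1 V2 V3 :: "('v \<Rightarrow> complex) set"
  assumes C: "set C1 \<subseteq> V1" "V1 \<subseteq> lf.span (set C1)" "length C1 = 5"
      "set C2 \<subseteq> V2" "V2 \<subseteq> lf.span (set C2)" "length C2 = 5"
      "set C3 \<subseteq> V3" "V3 \<subseteq> lf.span (set C3)" "length C3 = 5"
    and zs: "eliminable zs (lf.span (V1 \<union> V2 \<union> V3))" "length zs = 6"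
    and G: "lf.independent G" "card G = 9"
      "G \<subseteq> {f \<in> lf.span (V1 \<union> V2 \<union> V3). \<forall>z\<in>set zs. f z = 0}"
  shows "lf.dim V1 = 5" "lf.dim V2 = 5" "lf.dim V3 = 5"
    and "\<lbrakk>set W1 \<subseteq> V1; length W1 = 5; lin_indep W1; set W2 \<subseteq> V2; length W2 = 5; lin_indep W2;
          set W3 \<subseteq> V3; length W3 = 5; lin_indep W3\<rbrakk> \<Longrightarrow>
        (\<exists>L. delta_integrals zs (W1 @ W2 @ W3) L) \<and>
        (\<forall>L. delta_integrals zs (W1 @ W2 @ W3) L \<longrightarrow> lin_indep L \<and> lf.span (set L) = lf.span G)"
proof -
  obtain B where B: "lf.independent B" "B \<subseteq> lf.span (V1 \<union> V2 \<union> V3)" "card B = 15"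
    using eliminable_extend[OF zs(1) G(1) _ G(3)] G(2) zs(2) card_ge_0_finite[of G] by auto
  have all: "lin_indep (D1 @ D2 @ D3) \<and> lf.span (set (D1 @ D2 @ D3)) = lf.span (V1 \<union> V2 \<union> V3)"
    if D: "set D1 \<subseteq> V1" "V1 \<subseteq> lf.span (set D1)" "length D1 = 5"
      "set D2 \<subseteq> V2" "V2 \<subseteq> lf.span (set D2)" "length D2 = 5"
      "set D3 \<subseteq> V3" "V3 \<subseteq> lf.span (set D3)" "length D3 = 5" for D1 D2 D3
  proof -
    have "V1 \<union> V2 \<union> V3 \<subseteq> lf.span (set (D1 @ D2 @ D3))"
      by (intro Un_least; rule subset_trans[OF _ lf.span_mono], rule D) auto
    hence 1: "lf.span (V1 \<union> V2 \<union> V3) \<subseteq> lf.span (set (D1 @ D2 @ D3))"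
      by (rule lf.span_minimal[OF _ lf.subspace_span])
    moreover have "lf.span (set (D1 @ D2 @ D3)) \<subseteq> lf.span (V1 \<union> V2 \<union> V3)"
      using D by (intro lf.span_mono) auto
    moreover have "lin_indep (D1 @ D2 @ D3)"
      by (rule lin_indepI_card[OF B(1)]) (use 1 B D in auto)
    ultimately show ?thesis by blast
  qed
  have "lin_indep (C1 @ C2 @ C3)" using all C by blast
  hence "lin_indep C1" "lin_indep C2" "lin_indep C3"
    by (auto dest: lin_indep_appendD)
  thus dims: "lf.dim V1 = 5" "lf.dim V2 = 5" "lf.dim V3 = 5"
    using C lf.dim_unique[of "set C1" V1] lf.dim_unique[of "set C2" V2] lf.dim_unique[of "set C3" V3]
    by (simp_all add: lin_indep_def distinct_card)
  \<comment> \<open>Five independent forms from \<open>V\<close> span it, so the argument for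
    spanning lists covers every admissible choice of weights.\<close>
  have spanning: "V \<subseteq> lf.span (set W)"
    if "set C \<subseteq> V" "V \<subseteq> lf.span (set C)" "length C = 5" "set W \<subseteq> V" "length W = 5" "lin_indep W"
    for C W and V :: "('v \<Rightarrow> complex) set"
  proof -
    have "lf.span (set C) = lf.span (set W)"
      using that distinct_card[of W] by (intro span_eq_of_card) (auto simp: lin_indep_def)
    thus ?thesis using that by simp
  qed
  show "(\<exists>L. delta_integrals zs (W1 @ W2 @ W3) L) \<and>
        (\<forall>L. delta_integrals zs (W1 @ W2 @ W3) L \<longrightarrow> lin_indep L \<and> lf.span (set L) = lf.span G)"
    if W: "set W1 \<subseteq> V1" "length W1 = 5" "lin_indep W1" "set W2 \<subseteq> V2" "length W2 = 5" "lin_indep W2"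
          "set W3 \<subseteq> V3" "length W3 = 5" "lin_indep W3"
  proof -
    have W15: "lin_indep (W1 @ W2 @ W3)" "lf.span (set (W1 @ W2 @ W3)) = lf.span (V1 \<union> V2 \<union> V3)"
      using all[of W1 W2 W3] W spanning[of C1 V1 W1] spanning[of C2 V2 W2] spanning[of C3 V3 W3] C
      by blast+
    have "\<exists>L. delta_integrals zs (W1 @ W2 @ W3) L"
      by (rule delta_integrals_exist) (use W15 zs in simp_all)
    moreover have "lin_indep L \<and> lf.span (set L) = lf.span G"
      if "delta_integrals zs (W1 @ W2 @ W3) L" for L
    proof -
      have L: "lin_indep L" "length L = 9"
        "lf.span (set L) = {f \<in> lf.span (V1 \<union> V2 \<union> V3). \<forall>z\<in>set zs. f z = 0}"
        using delta_integrals_span[OF that W15(1)] W15 W zs by auto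
      \<comment> \<open>Of fifteen forms nine remain, and the nine of \<open>G\<close> lie in their
        span.\<close>
      have "lf.span (set L) = lf.span G"
        by (rule span_eq_of_card) (use L(2,3) G in simp_all)
      thus ?thesis using L(1) by blast
    qed
    ultimately show ?thesis by blast
  qed
qed

section \<open>The forms of one pentachoron\<close>

text \<open>For a cocycle \<open>\<omega>\<close> and \<open>n = nu \<omega>\<close>, the last
  expression is \<open>n i k\<close> times \<open>\<omega> (i, j, k) + 1\<close>.\<close>

definition nondegenerate :: "(nat \<Rightarrow> nat \<Rightarrow> complex) \<Rightarrow> bool" where
  "nondegenerate n \<longleftrightarrow>
     (\<forall>i j. 1 \<le> i \<and> i < j \<and> j \<le> 6 \<longrightarrow> n i j \<noteq> 0) \<and>
     (\<forall>i j k. 1 \<le> i \<and> i < j \<and> j < k \<and> k \<le> 6 \<longrightarrow> n i j * n j k + n i k \<noteq> 0)"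

lemma nondegenerate_nu:
  assumes "\<omega> \<in> cocycles" "\<forall>s\<in>triangles. \<omega> s \<noteq> -1"
  shows "nondegenerate (nu \<omega>)"
proof -
  have nz: "nu \<omega> i j \<noteq> 0" if "1 \<le> i" "i < j" "j \<le> 6" for i j
  proof (cases "i = 1")
    case False
    hence "(1, i, j) \<in> triangles" using that by (auto simp: triangles_def)
    hence "\<omega> (1, i, j) \<noteq> 0" using assms(1) unfolding cocycles_def by blast
    thus ?thesis using False by (simp add: nu_def)
  qed (simp add: nu_def)
  have "nu \<omega> i j * nu \<omega> j k + nu \<omega> i k \<noteq> 0" if ijk: "1 \<le> i" "i < j" "j < k" "k \<le> 6" for i j k
  proof -
    have t: "(i, j, k) \<in> triangles" using ijk by (auto simp: triangles_def)
    have "nu \<omega> i j * nu \<omega> j k = nu \<omega> i k * \<omega> (i, j, k)"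
    proof (cases "i = 1")
      case True thus ?thesis using ijk by (simp add: nu_def)
    next
      case False
      have "{1, i, j, k} \<subseteq> {1..6} \<and> distinct [1, i, j, k]" using ijk False by auto
      hence "\<omega> (1, i, j) * \<omega> (1, j, k) = \<omega> (1, i, k) * \<omega> (i, j, k)"
        using assms(1) unfolding cocycles_def by blast
      thus ?thesis using ijk False by (simp add: nu_def)
    qed
    hence "nu \<omega> i j * nu \<omega> j k + nu \<omega> i k = nu \<omega> i k * (\<omega> (i, j, k) + 1)"
      by (simp add: algebra_simps)
    moreover have "\<omega> (i, j, k) + 1 \<noteq> 0"
      using assms(2) t by (auto simp: add_eq_0_iff2)
    ultimately show ?thesis using nz ijk by simp
  qed
  thus ?thesis using nz by (simp add: nondegenerate_def)
qed

text \<open>Within each tetrahedron, \<open>xi\<close> and \<open>eta\<close> already satisfy such a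
  relation at every vertex, identically in \<open>n\<close>; alternating sums inherit it.\<close>

lemma phi_vertex_relations:
  fixes a b c d e :: nat
  assumes "a < b" "b < c" "c < d" "d < e" "n = nu \<omega>" "p = phi \<omega> (a, b, c, d, e)"
  shows "n a b * p (a, b) z + n a c * p (a, c) z + n a d * p (a, d) z + n a e * p (a, e) z = 0"
    and "p (a, b) z + n b c * p (b, c) z + n b d * p (b, d) z + n b e * p (b, e) z = 0"
    and "p (a, c) z + p (b, c) z + n c d * p (c, d) z + n c e * p (c, e) z = 0"
    and "p (a, d) z + p (b, d) z + p (c, d) z + n d e * p (d, e) z = 0"
    and "p (a, e) z + p (b, e) z + p (c, e) z + p (d, e) z = 0"
  using assms(1-4) unfolding assms(5,6)
  by (cases z; auto simp: tet_form_def algebra_simps)+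

text \<open>The other five edges form the triangle \<open>abc\<close> with \<open>ad\<close> and \<open>ae\<close> attached. The relations at \<open>d\<close>
  and \<open>e\<close> express \<open>\<phi>\<^bsub>ad\<^esub>\<close> and \<open>\<phi>\<^bsub>ae\<^esub>\<close>; the system left for the triangle has determinant
  \<open>-(\<nu>\<^bsub>ab\<^esub> \<nu>\<^bsub>bc\<^esub> + \<nu>\<^bsub>ac\<^esub>)\<close>.\<close>

definition basic_forms :: "(nat \<times> nat \<times> nat \<Rightarrow> complex) \<Rightarrow> pent \<Rightarrow> form list" where
  "basic_forms \<omega> v = (case v of (a, b, c, d, e) \<Rightarrow>
     map (phi \<omega> v) [(b, d), (c, d), (b, e), (c, e), (d, e)])"

lemma basic_forms_span:
  assumes nd: "nondegenerate (nu \<omega>)" and v: "v \<in> pentachora"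
  shows "set (basic_forms \<omega> v) \<subseteq> phi \<omega> v ` edges v"
    and "phi \<omega> v ` edges v \<subseteq> lf.span (set (basic_forms \<omega> v))"
    and "length (basic_forms \<omega> v) = 5"
proof -
  obtain a b c d e where v_eq: "v = (a, b, c, d, e)" by (cases v)
  have ord: "1 \<le> a" "a < b" "b < c" "c < d" "d < e" "e \<le> 6"
    using v by (auto simp: v_eq pentachora_def)
  define n where "n = nu \<omega>"
  define p where "p = phi \<omega> (a, b, c, d, e)"
  define S where "S = lf.span (set (basic_forms \<omega> v))"
  define k where "k = n a b * n b c + n a c"
  have k: "k \<noteq> 0" using nd ord by (simp add: nondegenerate_def n_def k_def)
  note rel = phi_vertex_relations[OF ord(2-5) n_def p_def]
  note S = lf.span_add[of _ "set (basic_forms \<omega> v)", folded S_def]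
    lf.span_diff[of _ "set (basic_forms \<omega> v)", folded S_def]
    lf.span_neg[of _ "set (basic_forms \<omega> v)", folded S_def]
    lf.span_scale[of _ "set (basic_forms \<omega> v)", folded S_def]
  have base: "p (b, d) \<in> S" "p (c, d) \<in> S" "p (b, e) \<in> S" "p (c, e) \<in> S" "p (d, e) \<in> S"
    by (auto simp: S_def basic_forms_def v_eq p_def simp del: phi.simps intro: lf.span_base)
  have "p (a, d) = - p (b, d) - p (c, d) - form_scale (n d e) (p (d, e))"
  proof
    fix z show "p (a, d) z = (- p (b, d) - p (c, d) - form_scale (n d e) (p (d, e))) z"
      using rel(4)[of z] by (simp add: form_scale_def) algebra
  qed
  hence ad: "p (a, d) \<in> S" using base by (simp add: S)
  have "p (a, e) = - p (b, e) - p (c, e) - p (d, e)"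
  proof
    fix z show "p (a, e) z = (- p (b, e) - p (c, e) - p (d, e)) z"
      using rel(5)[of z] by simp algebra
  qed
  hence ae: "p (a, e) \<in> S" using base by (simp add: S)
  \<comment> \<open>Inserting \<open>p (a, b)\<close> and \<open>p (a, c)\<close> from the relations
    at \<open>b\<close> and \<open>c\<close> into the one at \<open>a\<close> leaves
    \<open>p (b, c)\<close> as the only form of the triangle, with coefficient
    \<open>-k\<close>.\<close>
  have "form_scale k (p (b, c)) = form_scale (n a d) (p (a, d)) + form_scale (n a e) (p (a, e))
      - form_scale (n a b) (form_scale (n b d) (p (b, d)) + form_scale (n b e) (p (b, e)))
      - form_scale (n a c) (form_scale (n c d) (p (c, d)) + form_scale (n c e) (p (c, e)))"
    (is "_ = ?R")
  proof
    fix z show "form_scale k (p (b, c)) z = ?R z"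
      using rel(1,2,3)[of z] unfolding k_def by (simp add: form_scale_def) algebra
  qed
  hence "form_scale k (p (b, c)) \<in> S" using base ad ae by (simp add: S)
  hence "form_scale (1 / k) (form_scale k (p (b, c))) \<in> S" by (rule S)
  hence bc: "p (b, c) \<in> S" using k by (simp add: form_scale_def)
  have "p (a, b) = - form_scale (n b c) (p (b, c)) - form_scale (n b d) (p (b, d))
      - form_scale (n b e) (p (b, e))" (is "_ = ?R")
  proof
    fix z show "p (a, b) z = ?R z" using rel(2)[of z] by (simp add: form_scale_def) algebra
  qed
  hence ab: "p (a, b) \<in> S" using base bc by (simp add: S)
  have "p (a, c) = - p (b, c) - form_scale (n c d) (p (c, d)) - form_scale (n c e) (p (c, e))"
    (is "_ = ?R")
  proof
    fix z show "p (a, c) z = ?R z" using rel(3)[of z] by (simp add: form_scale_def) algebra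
  qed
  hence ac: "p (a, c) \<in> S" using base bc by (simp add: S)
  have "p (r, s) \<in> S" if "r \<in> {a, b, c, d, e}" "s \<in> {a, b, c, d, e}" "r < s" for r s
    using that ord(2-5) base ad ae bc ab ac
    by (simp only: insert_iff empty_iff simp_thms) (elim disjE; simp)
  thus "phi \<omega> v ` edges v \<subseteq> lf.span (set (basic_forms \<omega> v))"
    by (auto simp: p_def S_def v_eq simp del: phi.simps)
  show "set (basic_forms \<omega> v) \<subseteq> phi \<omega> v ` edges v"
    using ord by (auto simp: basic_forms_def v_eq simp del: phi.simps)
  show "length (basic_forms \<omega> v) = 5"
    by (simp add: basic_forms_def v_eq)
qed

lemma xi_eta_eq_0:
  assumes "i < j" "j < k" "k < l" "\<not> (r < s \<and> {r, s} \<subseteq> {i, j, k, l})"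
  shows "xi n (i, j, k, l) (r, s) = 0" "eta n (i, j, k, l) (r, s) = 0"
proof -
  have "(r, s) \<notin> {(i,j), (i,k), (i,l), (j,k), (j,l), (k,l)}"
    using assms by auto
  thus "xi n (i, j, k, l) (r, s) = 0" "eta n (i, j, k, l) (r, s) = 0" by auto
qed

lemma tet_form_eq_0:
  assumes "i < j" "j < k" "k < l" "\<not> (r < s \<and> {r, s} \<subseteq> {i, j, k, l})"
  shows "tet_form n (i, j, k, l) (r, s) = 0"
  using xi_eta_eq_0[OF assms]
  by (auto simp: tet_form_def fun_eq_iff simp del: xi.simps eta.simps split: var.split)

text \<open>Needed because boundary sums evaluate \<open>phi\<close> also at edges outside the
  pentachoron, where no tetrahedron contributes.\<close>

lemma phi_in_span:
  assumes "v \<in> pentachora"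
  shows "phi \<omega> v q \<in> lf.span (phi \<omega> v ` edges v)"
proof (cases "q \<in> edges v")
  case True thus ?thesis by (intro lf.span_base) blast
next
  case False
  thus ?thesis using assms
    by (cases v; cases q) (auto simp: pentachora_def tet_form_eq_0 lf.span_zero)
qed

lemma nondegenerateD:
  assumes "nondegenerate n"
  shows "\<lbrakk>1 \<le> i; i < j; j \<le> 6\<rbrakk> \<Longrightarrow> n i j \<noteq> 0"
    and "\<lbrakk>1 \<le> i; i < j; j < k; k \<le> 6\<rbrakk> \<Longrightarrow> n i j * n j k + n i k \<noteq> 0"
    and "\<lbrakk>1 \<le> i; i < j; j < k; k \<le> 6\<rbrakk> \<Longrightarrow> - (n i j * n j k) \<noteq> n i k"
    and "\<lbrakk>1 \<le> i; i < j; j < k; k \<le> 6\<rbrakk> \<Longrightarrow> - (n i j * n j k) - n i k \<noteq> 0"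
  using assms by (auto simp: nondegenerate_def neg_eq_iff_add_eq_0)

section \<open>Forms common to both sides\<close>

text \<open>The signs are those of the simplicial boundary, restricted to the facets omitting 1, 2
  or 3; the tetrahedra 1456, 2456 and 3456 cancel.\<close>

definition boundary_form :: "(nat \<times> nat \<times> nat \<Rightarrow> complex) \<Rightarrow> edge \<Rightarrow> form" where
  "boundary_form \<omega> b = phi \<omega> (2,3,4,5,6) b - phi \<omega> (1,3,4,5,6) b + phi \<omega> (1,2,4,5,6) b"

text \<open>Each tetrahedron lies in two of the six pentachora and has opposite signs there in the
  full alternating sum, as in the boundary of a boundary.\<close>

lemma boundary_form_eq:
  "boundary_form \<omega> b = phi \<omega> (1,2,3,5,6) b - phi \<omega> (1,2,3,4,6) b + phi \<omega> (1,2,3,4,5) b"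
  by (simp add: boundary_form_def algebra_simps)

text \<open>The complement of the edges at vertex 1 together with the edge 24. In a linear dependency the
  coefficients of these edges can then be shown to vanish tetrahedron by tetrahedron, in the order
  1245, 1246, 1256, 1345, 1346, 2345, each time with at most two coefficients left.\<close>

definition free_edges :: "edge set" where
  "free_edges = {(2,3), (2,5), (2,6), (3,4), (3,5), (3,6), (4,5), (4,6), (5,6)}"

lemma cramer:
  fixes x y :: complex
  assumes "x * a + y * b = 0" "x * c + y * d = 0" "a * d - b * c \<noteq> 0"
  shows "x = 0 \<and> y = 0"
proof -
  have "x * (a * d - b * c) = 0" "y * (a * d - b * c) = 0"
    using assms(1,2) by algebra+
  thus ?thesis using assms(3) by simp
qed

lemma boundary_forms_independent:
  assumes nd: "nondegenerate (nu \<omega>)"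
  shows "inj_on (boundary_form \<omega>) free_edges \<and> lf.independent (boundary_form \<omega> ` free_edges)"
proof (rule independent_imageI)
  show "finite free_edges" by (simp add: free_edges_def)
  fix c assume "\<And>z. (\<Sum>b\<in>free_edges. c b * boundary_form \<omega> b z) = 0"
  hence dep: "c (2,3) * F (2,3) z + c (2,5) * F (2,5) z + c (2,6) * F (2,6) z + c (3,4) * F (3,4) z
    + c (3,5) * F (3,5) z + c (3,6) * F (3,6) z + c (4,5) * F (4,5) z + c (4,6) * F (4,6) z
    + c (5,6) * F (5,6) z = 0" if "F = boundary_form \<omega>" for z F
    using that by (simp add: free_edges_def add.assoc)
  define n where "n = nu \<omega>"
  note nz = nondegenerateD[OF nd, folded n_def]
  have det1: "xi n (i,j,k,l) (j,l) * eta n (i,j,k,l) (k,l) - xi n (i,j,k,l) (k,l) * eta n (i,j,k,l) (j,l) \<noteq> 0"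
    if "1 \<le> i" "i < j" "j < k" "k < l" "l \<le> 6" for i j k l
  proof -
    have "xi n (i,j,k,l) (j,l) * eta n (i,j,k,l) (k,l) - xi n (i,j,k,l) (k,l) * eta n (i,j,k,l) (j,l)
      = - ((n i j * n j k + n i k) * (n i k * (n j k * n k l + n j l)))"
      using that by (simp add: algebra_simps)
    thus ?thesis using that nz(1)[of i k] nz(2)[of i j k] nz(2)[of j k l] by simp
  qed
  have det2: "xi n (i,j,k,l) (j,k) * eta n (i,j,k,l) (j,l) - xi n (i,j,k,l) (j,l) * eta n (i,j,k,l) (j,k) \<noteq> 0"
    if "1 \<le> i" "i < j" "j < k" "k < l" "l \<le> 6" for i j k l
  proof -
    have "xi n (i,j,k,l) (j,k) * eta n (i,j,k,l) (j,l) - xi n (i,j,k,l) (j,l) * eta n (i,j,k,l) (j,k)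
      = - ((n i k * n k l + n i l) * (n i k * (n j k * n k l + n j l)))"
      using that by (simp add: algebra_simps)
    thus ?thesis using that nz(1)[of i k] nz(2)[of i k l] nz(2)[of j k l] by simp
  qed
  \<comment> \<open>The dependency read at a single variable \<open>X t\<close> or
    \<open>Y t\<close>, where only the free edges of \<open>t\<close> contribute.\<close>
  note at = dep[OF refl, unfolded boundary_form_def phi.simps, folded n_def]
  note ev = tet_form_def xi_eta_eq_0
  note xi.simps [simp del] eta.simps [simp del] One_nat_def [simp del]
  have c25: "c (2,5) = 0 \<and> c (4,5) = 0"
  proof (rule cramer[OF _ _ det1[of 1 2 4 5]])
    show "c (2,5) * xi n (1,2,4,5) (2,5) + c (4,5) * xi n (1,2,4,5) (4,5) = 0"
      using at[of "X (1,2,4,5)"] by (simp add: ev)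
    show "c (2,5) * eta n (1,2,4,5) (2,5) + c (4,5) * eta n (1,2,4,5) (4,5) = 0"
      using at[of "Y (1,2,4,5)"] by (simp add: ev)
  qed simp_all
  have c26: "c (2,6) = 0 \<and> c (4,6) = 0"
  proof (rule cramer[OF _ _ det1[of 1 2 4 6]])
    show "c (2,6) * xi n (1,2,4,6) (2,6) + c (4,6) * xi n (1,2,4,6) (4,6) = 0"
      using at[of "X (1,2,4,6)"] by (simp add: ev) algebra
    show "c (2,6) * eta n (1,2,4,6) (2,6) + c (4,6) * eta n (1,2,4,6) (4,6) = 0"
      using at[of "Y (1,2,4,6)"] by (simp add: ev) algebra
  qed simp_all
  \<comment> \<open>The \<open>Y\<close> equation is used because the \<open>xi\<close> coefficient
    of 56 can vanish, while its \<open>eta\<close> coefficient is minus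
    \<open>n 1 2 * n 2 5 + n 1 5\<close>.\<close>
  have c56: "c (5,6) = 0"
    using at[of "Y (1,2,5,6)"] c25 c26 nz(2,3,4)[of 1 2 5] by (simp add: tet_form_def xi.simps eta.simps)
  have c34: "c (3,4) = 0 \<and> c (3,5) = 0"
  proof (rule cramer[OF _ _ det2[of 1 3 4 5]])
    show "c (3,4) * xi n (1,3,4,5) (3,4) + c (3,5) * xi n (1,3,4,5) (3,5) = 0"
      using at[of "X (1,3,4,5)"] c25 by (simp add: ev) algebra
    show "c (3,4) * eta n (1,3,4,5) (3,4) + c (3,5) * eta n (1,3,4,5) (3,5) = 0"
      using at[of "Y (1,3,4,5)"] c25 by (simp add: ev) algebra
  qed simp_all
  have c36: "c (3,6) = 0"
    using at[of "Y (1,3,4,6)"] c34 c26 nz(2,3,4)[of 1 3 4] by (simp add: tet_form_def xi.simps eta.simps)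
  \<comment> \<open>As 23 is the first edge of 2345, its \<open>xi\<close> is 0 and only the
    \<open>Y\<close> equation helps.\<close>
  have "c (2,3) = 0"
    using at[of "Y (2,3,4,5)"] c34 c25 nz(1)[of 2 4] nz(2,3)[of 3 4 5]
    by (simp add: tet_form_def xi.simps eta.simps)
  with c25 c26 c56 c34 c36 show "\<forall>b\<in>free_edges. c b = 0"
    by (simp add: free_edges_def)
qed

section \<open>Pivots for the inner variables\<close>

text \<open>In a tetrahedron \<open>123m\<close>, the edge \<open>1m\<close> carries only
  \<open>x\<close> and the edge 12 only \<open>y\<close>, with nonzero coefficients. For 1235 the
  pivots come from 12356, which does not contain 1234.\<close>

lemma inner_123_eliminable:
  fixes \<omega>
  defines "S \<equiv> lf.span (phi \<omega> (1,2,3,4,5) ` edges (1,2,3,4,5) \<union> phi \<omega> (1,2,3,4,6) ` edges (1,2,3,4,6)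
      \<union> phi \<omega> (1,2,3,5,6) ` edges (1,2,3,5,6))"
  assumes nd: "nondegenerate (nu \<omega>)"
  shows "eliminable [X (1,2,3,4), Y (1,2,3,4), X (1,2,3,5), Y (1,2,3,5), X (1,2,3,6), Y (1,2,3,6)] S"
proof -
  \<comment> \<open>In both inner variables of 1236, the forms of the edges 16 and 26 are independent, but only the
    edge 12 has a form without \<open>x\<^bsub>1236\<^esub>\<close>, and it contains variables eliminated earlier.\<close>
  define f where "f = form_scale (xi (nu \<omega>) (1,2,3,6) (1,6)) (phi \<omega> (1,2,3,4,6) (2,6))
    - form_scale (xi (nu \<omega>) (1,2,3,6) (2,6)) (phi \<omega> (1,2,3,4,6) (1,6))"
  have S: "phi \<omega> (1,2,3,4,5) b \<in> S" if "b \<in> edges (1,2,3,4,5)" for b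
    unfolding S_def using that by (intro lf.span_base) blast
  have S': "phi \<omega> (1,2,3,4,6) b \<in> S" if "b \<in> edges (1,2,3,4,6)" for b
    unfolding S_def using that by (intro lf.span_base) blast
  have S'': "phi \<omega> (1,2,3,5,6) b \<in> S" if "b \<in> edges (1,2,3,5,6)" for b
    unfolding S_def using that by (intro lf.span_base) blast
  have mem: "phi \<omega> (1,2,3,4,5) (1,4) \<in> S" "phi \<omega> (1,2,3,4,5) (1,2) \<in> S"
      "phi \<omega> (1,2,3,5,6) (1,5) \<in> S" "phi \<omega> (1,2,3,5,6) (1,2) \<in> S"
      "phi \<omega> (1,2,3,4,6) (1,6) \<in> S" "phi \<omega> (1,2,3,4,6) (2,6) \<in> S"
    by (rule S S' S''; simp)+
  have f: "f \<in> S"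
    unfolding f_def using mem unfolding S_def by (intro lf.span_diff lf.span_scale)
  note nz = nondegenerateD[OF nd]
  note ev = tet_form_def nz form_scale_def
  note One_nat_def [simp del]
  show ?thesis
    unfolding eliminable.simps
    apply (intro conjI)
    apply (rule bexI[of _ "phi \<omega> (1,2,3,4,5) (1,4)"]; use mem in \<open>simp add: ev\<close>)
    apply (rule bexI[of _ "phi \<omega> (1,2,3,4,5) (1,2)"]; use mem in \<open>simp add: ev\<close>)
    apply (rule bexI[of _ "phi \<omega> (1,2,3,5,6) (1,5)"]; use mem in \<open>simp add: ev\<close>)
    apply (rule bexI[of _ "phi \<omega> (1,2,3,5,6) (1,2)"]; use mem in \<open>simp add: ev\<close>)
    apply (rule bexI[of _ "phi \<omega> (1,2,3,4,6) (1,6)"]; use mem in \<open>simp add: ev\<close>)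
    \<comment> \<open>Since \<open>eta\<close> vanishes at 16, the \<open>y\<close> coefficient of
      \<open>f\<close> is, up to sign, \<open>xi\<close> at 16 times \<open>eta\<close> at 26, and
      neither is 0.\<close>
    apply (rule bexI[of _ f]; use f in \<open>simp add: f_def ev\<close>)
    apply simp
    done
qed

text \<open>For \<open>m\<close> in 1, 2, 3 the edges \<open>m6\<close> and \<open>m4\<close> lie in
  only one inner tetrahedron, \<open>m456\<close>. The first carries only its \<open>x\<close> and
  the second only its \<open>y\<close>, so the pivots do not interfere.\<close>

lemma inner_456_eliminable:
  fixes \<omega>
  defines "S \<equiv> lf.span (phi \<omega> (1,2,4,5,6) ` edges (1,2,4,5,6) \<union> phi \<omega> (1,3,4,5,6) ` edges (1,3,4,5,6)
      \<union> phi \<omega> (2,3,4,5,6) ` edges (2,3,4,5,6))"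
  assumes nd: "nondegenerate (nu \<omega>)"
  shows "eliminable [X (1,4,5,6), Y (1,4,5,6), X (2,4,5,6), Y (2,4,5,6), X (3,4,5,6), Y (3,4,5,6)] S"
proof -
  have S: "phi \<omega> (1,2,4,5,6) b \<in> S" if "b \<in> edges (1,2,4,5,6)" for b
    unfolding S_def using that by (intro lf.span_base) blast
  have S': "phi \<omega> (1,3,4,5,6) b \<in> S" if "b \<in> edges (1,3,4,5,6)" for b
    unfolding S_def using that by (intro lf.span_base) blast
  have S'': "phi \<omega> (2,3,4,5,6) b \<in> S" if "b \<in> edges (2,3,4,5,6)" for b
    unfolding S_def using that by (intro lf.span_base) blast
  have mem: "phi \<omega> (1,2,4,5,6) (1,6) \<in> S" "phi \<omega> (1,2,4,5,6) (1,4) \<in> S"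
      "phi \<omega> (2,3,4,5,6) (2,6) \<in> S" "phi \<omega> (2,3,4,5,6) (2,4) \<in> S"
      "phi \<omega> (1,3,4,5,6) (3,6) \<in> S" "phi \<omega> (1,3,4,5,6) (3,4) \<in> S"
    by (rule S S' S''; simp)+
  note nz = nondegenerateD[OF nd]
  note ev = tet_form_def nz form_scale_def
  note One_nat_def [simp del]
  show ?thesis
    unfolding eliminable.simps
    apply (intro conjI)
    apply (rule bexI[of _ "phi \<omega> (1,2,4,5,6) (1,6)"]; use mem in \<open>simp add: ev\<close>)
    apply (rule bexI[of _ "phi \<omega> (1,2,4,5,6) (1,4)"]; use mem in \<open>simp add: ev\<close>)
    apply (rule bexI[of _ "phi \<omega> (2,3,4,5,6) (2,6)"]; use mem in \<open>simp add: ev\<close>)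
    apply (rule bexI[of _ "phi \<omega> (2,3,4,5,6) (2,4)"]; use mem in \<open>simp add: ev\<close>)
    apply (rule bexI[of _ "phi \<omega> (1,3,4,5,6) (3,6)"]; use mem in \<open>simp add: ev\<close>)
    apply (rule bexI[of _ "phi \<omega> (1,3,4,5,6) (3,4)"]; use mem in \<open>simp add: ev\<close>)
    apply simp
    done
qed

section \<open>The open set of cocycles\<close>

lemma prod_poly_functions:
  assumes "finite A" "\<And>a. a \<in> A \<Longrightarrow> p a \<in> poly_functions I"
  shows "(\<lambda>x. \<Prod>a\<in>A. p a x) \<in> poly_functions I"
  using assms by (induction A rule: finite_induct) (auto intro: poly_functions.intros)

text \<open>The complement is the zero set of one polynomial, a product over the finitely many
  triangles.\<close>

lemma zariski_open_avoiding_minus_one: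
  "zariski_open_in triangles cocycles {\<omega> \<in> cocycles. \<forall>s\<in>triangles. \<omega> s \<noteq> -1}"
proof -
  define p :: "(nat \<times> nat \<times> nat \<Rightarrow> complex) \<Rightarrow> complex" where "p = (\<lambda>\<omega>. \<Prod>s\<in>triangles. \<omega> s + 1)"
  have fin: "finite triangles"
    by (rule finite_subset[of _ "{1..6} \<times> {1..6} \<times> {1..6}"]) (auto simp: triangles_def)
  have "p \<in> poly_functions triangles"
    unfolding p_def using fin by (intro prod_poly_functions poly_functions.intros)
  moreover have "p \<omega> = 0 \<longleftrightarrow> (\<exists>s\<in>triangles. \<omega> s = -1)" for \<omega>
    using fin by (simp add: p_def add_eq_0_iff2)
  ultimately show ?thesis
    unfolding zariski_open_in_def zariski_closed_in_def
    by (intro conjI exI[of _ "{p}"]) auto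
qed

lemma trivial_cocycle: "(\<lambda>s\<in>triangles. 1) \<in> cocycles"
  by (auto simp: cocycles_def triangles_def)

section \<open>Comparison of the two integrals\<close>

lemma integrals_nondegenerate:
  assumes nd: "nondegenerate (nu \<omega>)"
  shows "v \<in> pentachora \<Longrightarrow> lf.dim (phi \<omega> v ` edges v) = 5"
    and "\<lbrakk>is_weight \<omega> (1,2,3,4,5) W1; is_weight \<omega> (1,2,3,4,6) W2; is_weight \<omega> (1,2,3,5,6) W3;
        zs = [X (1,2,3,4), Y (1,2,3,4), X (1,2,3,5), Y (1,2,3,5), X (1,2,3,6), Y (1,2,3,6)]\<rbrakk> \<Longrightarrow>
      (\<exists>L. delta_integrals zs (W1 @ W2 @ W3) L) \<and>
      (\<forall>L. delta_integrals zs (W1 @ W2 @ W3) L \<longrightarrow>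
        lin_indep L \<and> lf.span (set L) = lf.span (boundary_form \<omega> ` free_edges))"
    and "\<lbrakk>is_weight \<omega> (1,2,4,5,6) W4; is_weight \<omega> (1,3,4,5,6) W5; is_weight \<omega> (2,3,4,5,6) W6;
        zs = [X (1,4,5,6), Y (1,4,5,6), X (2,4,5,6), Y (2,4,5,6), X (3,4,5,6), Y (3,4,5,6)]\<rbrakk> \<Longrightarrow>
      (\<exists>R. delta_integrals zs (W4 @ W5 @ W6) R) \<and>
      (\<forall>R. delta_integrals zs (W4 @ W5 @ W6) R \<longrightarrow>
        lin_indep R \<and> lf.span (set R) = lf.span (boundary_form \<omega> ` free_edges))"
proof -
  define V where "V v = phi \<omega> v ` edges v" for v
  define G where "G = boundary_form \<omega> ` free_edges"
  have G: "lf.independent G" "card G = 9"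
    using boundary_forms_independent[OF nd] card_image[of "boundary_form \<omega>" free_edges]
    by (auto simp: G_def free_edges_def)
  have pent: "(1,2,3,4,5) \<in> pentachora" "(1,2,3,4,6) \<in> pentachora" "(1,2,3,5,6) \<in> pentachora"
    "(1,2,4,5,6) \<in> pentachora" "(1,3,4,5,6) \<in> pentachora" "(2,3,4,5,6) \<in> pentachora"
    by (simp_all add: pentachora_def)
  have phi_V: "phi \<omega> v b \<in> lf.span S" if "v \<in> pentachora" "V v \<subseteq> S" for v b S
    using phi_in_span[OF that(1)] lf.span_mono[OF that(2)] unfolding V_def by blast
  define zl where "zl = [X (1,2,3,4), Y (1,2,3,4), X (1,2,3,5), Y (1,2,3,5), X (1,2,3,6), Y (1,2,3,6)]"
  define zr where "zr = [X (1,4,5,6), Y (1,4,5,6), X (2,4,5,6), Y (2,4,5,6), X (3,4,5,6), Y (3,4,5,6)]"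
  have Gl: "G \<subseteq> {f \<in> lf.span (V (1,2,3,4,5) \<union> V (1,2,3,4,6) \<union> V (1,2,3,5,6)). \<forall>z\<in>set zl. f z = 0}"
  proof -
    have "boundary_form \<omega> b \<in> lf.span (V (1,2,3,4,5) \<union> V (1,2,3,4,6) \<union> V (1,2,3,5,6))" for b
      unfolding boundary_form_eq
      by (intro lf.span_add lf.span_diff phi_V pent) auto
    \<comment> \<open>No pentachoron in \<open>boundary_form_def\<close> contains 1, 2 and 3
      together. For the other side, none in \<open>boundary_form_eq\<close> contains 4, 5 and 6
      together.\<close>
    moreover have "boundary_form \<omega> b z = 0" if "z \<in> set zl" for b z
      using that by (auto simp: zl_def boundary_form_def tet_form_def simp del: xi.simps eta.simps)
    ultimately show ?thesis by (auto simp: G_def)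
  qed
  have Gr: "G \<subseteq> {f \<in> lf.span (V (1,2,4,5,6) \<union> V (1,3,4,5,6) \<union> V (2,3,4,5,6)). \<forall>z\<in>set zr. f z = 0}"
  proof -
    have "boundary_form \<omega> b \<in> lf.span (V (1,2,4,5,6) \<union> V (1,3,4,5,6) \<union> V (2,3,4,5,6))" for b
      unfolding boundary_form_def
      by (intro lf.span_add lf.span_diff phi_V pent) auto
    moreover have "boundary_form \<omega> b z = 0" if "z \<in> set zr" for b z
      using that by (auto simp: zr_def boundary_form_eq tet_form_def simp del: xi.simps eta.simps)
    ultimately show ?thesis by (auto simp: G_def)
  qed
  note bf = basic_forms_span[OF nd, folded V_def]
  note left = integral_of_weights[OF bf[OF pent(1)] bf[OF pent(2)] bf[OF pent(3)]
      inner_123_eliminable[OF nd, folded V_def zl_def] _ G Gl]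
  note right = integral_of_weights[OF bf[OF pent(4)] bf[OF pent(5)] bf[OF pent(6)]
      inner_456_eliminable[OF nd, folded V_def zr_def] _ G Gr]
  have len: "length zl = 6" "length zr = 6" by (simp_all add: zl_def zr_def)
  \<comment> \<open>Every pentachoron occurs on one of the two sides, so the two counts give all
    dimensions.\<close>
  have "v \<in> {(1,2,3,4,5), (1,2,3,4,6), (1,2,3,5,6), (1,2,4,5,6), (1,3,4,5,6), (2,3,4,5,6)}"
    if "v \<in> pentachora" for v
  proof -
    obtain a b c d e where v: "v = (a, b, c, d, e)" by (cases v)
    have ord: "1 \<le> a" "a < b" "b < c" "c < d" "d < e" "e \<le> 6"
      using that by (auto simp: v pentachora_def)
    hence "a \<in> {1, 2}" "b \<in> {2, 3}" "c \<in> {3, 4}" "d \<in> {4, 5}" "e \<in> {5, 6}" by auto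
    thus ?thesis using ord unfolding v by (elim insertE emptyE) simp_all
  qed
  thus "lf.dim (phi \<omega> v ` edges v) = 5" if "v \<in> pentachora"
    using left(1-3)[OF len(1)] right(1-3)[OF len(2)] that unfolding V_def[symmetric] by blast
  show "(\<exists>L. delta_integrals zs (W1 @ W2 @ W3) L) \<and>
      (\<forall>L. delta_integrals zs (W1 @ W2 @ W3) L \<longrightarrow>
        lin_indep L \<and> lf.span (set L) = lf.span (boundary_form \<omega> ` free_edges))"
    if "is_weight \<omega> (1,2,3,4,5) W1" "is_weight \<omega> (1,2,3,4,6) W2" "is_weight \<omega> (1,2,3,5,6) W3"
      "zs = [X (1,2,3,4), Y (1,2,3,4), X (1,2,3,5), Y (1,2,3,5), X (1,2,3,6), Y (1,2,3,6)]"
    using left(4)[OF len(1), of W1 W2 W3] that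
    unfolding is_weight_def V_def[symmetric] G_def[symmetric] zl_def[symmetric] by blast
  show "(\<exists>R. delta_integrals zs (W4 @ W5 @ W6) R) \<and>
      (\<forall>R. delta_integrals zs (W4 @ W5 @ W6) R \<longrightarrow>
        lin_indep R \<and> lf.span (set R) = lf.span (boundary_form \<omega> ` free_edges))"
    if "is_weight \<omega> (1,2,4,5,6) W4" "is_weight \<omega> (1,3,4,5,6) W5" "is_weight \<omega> (2,3,4,5,6) W6"
      "zs = [X (1,4,5,6), Y (1,4,5,6), X (2,4,5,6), Y (2,4,5,6), X (3,4,5,6), Y (3,4,5,6)]"
    using right(4)[OF len(2), of W4 W5 W6] that
    unfolding is_weight_def V_def[symmetric] G_def[symmetric] zr_def[symmetric] by blast
qed

theorem theorem5:
  shows "\<exists>U. zariski_open_in triangles cocycles U \<and> U \<noteq> {} \<and>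
    (\<forall>\<omega>\<in>U.
      (\<forall>s\<in>triangles. \<omega> s \<noteq> -1) \<and>
      (\<forall>v\<in>pentachora. lf.dim (phi \<omega> v ` edges v) = 5) \<and>
      (\<forall>W12345 W12346 W12356 W12456 W13456 W23456.
        is_weight \<omega> (1,2,3,4,5) W12345 \<and> is_weight \<omega> (1,2,3,4,6) W12346 \<and>
        is_weight \<omega> (1,2,3,5,6) W12356 \<and> is_weight \<omega> (1,2,4,5,6) W12456 \<and>
        is_weight \<omega> (1,3,4,5,6) W13456 \<and> is_weight \<omega> (2,3,4,5,6) W23456 \<longrightarrow>
        (let lhs = delta_integrals
               [X (1,2,3,4), Y (1,2,3,4), X (1,2,3,5), Y (1,2,3,5), X (1,2,3,6), Y (1,2,3,6)]
               (W12345 @ W12346 @ W12356);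
             rhs = delta_integrals
               [X (1,4,5,6), Y (1,4,5,6), X (2,4,5,6), Y (2,4,5,6), X (3,4,5,6), Y (3,4,5,6)]
               (W12456 @ W13456 @ W23456)
         in (\<exists>L. lhs L) \<and> (\<exists>R. rhs R) \<and> (\<forall>L R. lhs L \<and> rhs R \<longrightarrow> delta_eq L R))))"
proof -
  let ?U = "{\<omega> \<in> cocycles. \<forall>s\<in>triangles. \<omega> s \<noteq> -1}"
  have nd: "nondegenerate (nu \<omega>)" if "\<omega> \<in> ?U" for \<omega>
    using that nondegenerate_nu by auto
  note dim = integrals_nondegenerate(1)[OF nd]
    and lhs = integrals_nondegenerate(2)[OF nd _ _ _ refl]
    and rhs = integrals_nondegenerate(3)[OF nd _ _ _ refl]
  show ?thesis
    unfolding Let_def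
  proof (rule exI[of _ ?U], intro conjI ballI allI impI, goal_cases)
    case 1 show ?case by (rule zariski_open_avoiding_minus_one)
  next
    case 2
    have "(\<lambda>s\<in>triangles. 1) \<in> ?U" using trivial_cocycle by auto
    thus ?case by blast
  next
    case 3 thus ?case by blast
  next
    case (4 \<omega> v) thus ?case using dim[of \<omega> v] by blast
  next
    case (5 \<omega> W12345 W12346 W12356 W12456 W13456 W23456)
    thus ?case using lhs[of \<omega> W12345 W12346 W12356] by blast
  next
    case (6 \<omega> W12345 W12346 W12356 W12456 W13456 W23456)
    thus ?case using rhs[of \<omega> W12456 W13456 W23456] by blast
  next
    case (7 \<omega> W12345 W12346 W12356 W12456 W13456 W23456 L R)
    from 7 have "lin_indep L \<and> lf.span (set L) = lf.span (boundary_form \<omega> ` free_edges)"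
      using lhs[of \<omega> W12345 W12346 W12356] by blast
    moreover from 7 have "lin_indep R \<and> lf.span (set R) = lf.span (boundary_form \<omega> ` free_edges)"
      using rhs[of \<omega> W12456 W13456 W23456] by blast
    ultimately show ?case by (simp add: delta_eq_def)
  qed
qed

end
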